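(* For a nonnegative integer $n$, let $Q(n)$ be the number of partitions of $n$ into distinct parts, and let $\widehat{Q}(n)$ be the number of partitions of $n$ in which all parts occur with the same multiplicity. Define the formal power series \[F_{\widehat{Q}}(q):=\sum_{n=1}^\infty \widehat{Q}(n)q^n,\qquad \Psi(Q;q):=\prod_{n=1}^\infty (1-q^n)^{Q(n)/n}.\] Then, as formal power series in $q$, \[\frac{q\frac{d}{dq}\Psi(Q;q)}{\Psi(Q;q)} = -F_{\widehat{Q}}(q).\] Moreover, for all $n\geq 1$, \[Q(n) = \sum_{d\mid n}\mu(d)\widehat{Q}(n/d),\] where $\mu$ denotes the classical M\"obius function. *)

theory Defs
  imports
    "HOL-Analysis.Infinite_Products"
    "HOL-Computational_Algebra.Computational_Algebra"
    "HOL-Library.Multiset"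
begin

definition partitions :: "nat \<Rightarrow> nat multiset set"
  where "partitions n = {P. 0 \<notin># P \<and> sum_mset P = n}"

definition Q :: "nat \<Rightarrow> nat"
  where "Q n = card {P \<in> partitions n. \<forall>x\<in>#P. count P x = 1}"

definition Qhat :: "nat \<Rightarrow> nat"
  where "Qhat n = card {P \<in> partitions n. \<forall>x\<in>#P. \<forall>y\<in>#P. count P x = count P y}"

text \<open>The sets counted above are finite, so \<^const>\<open>card\<close> is the true cardinality.\<close>

lemma finite_partitions: "finite (partitions n)"
proof -
  have small: "set_mset P \<subseteq> {1..n} \<and> size P \<le> n" if P: "P \<in> partitions n" for P
  proof
    show "set_mset P \<subseteq> {1..n}"
    proof
      fix x assume x: "x \<in># P"
      then obtain R where "P = add_mset x R"
        by (metis mset_add)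
      with P have "x \<le> n" "x \<noteq> 0"
        by (auto simp: partitions_def)
      then show "x \<in> {1..n}"
        by simp
    qed
    have "size R \<le> sum_mset R" if "0 \<notin># R" for R :: "nat multiset"
      using that by (induction R) auto
    with P show "size P \<le> n"
      by (auto simp: partitions_def)
  qed
  have "partitions n \<subseteq> (\<Union>k\<le>n. mset ` {xs. set xs \<subseteq> {1..n} \<and> length xs = k})"
  proof
    fix P assume P: "P \<in> partitions n"
    obtain xs where xs: "P = mset xs"
      by (metis ex_mset)
    with small[OF P] have "set xs \<subseteq> {1..n}" "length xs \<le> n"
      by auto
    with xs show "P \<in> (\<Union>k\<le>n. mset ` {xs. set xs \<subseteq> {1..n} \<and> length xs = k})"
      by blast
  qed
  then show ?thesis
    by (rule finite_subset) (simp add: finite_lists_length_eq)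
qed

definition moebius_mu :: "nat \<Rightarrow> int"
  where "moebius_mu n = (if squarefree n then (-1) ^ card (prime_factors n) else 0)"

definition F :: "(nat \<Rightarrow> nat) \<Rightarrow> rat fps"
  where "F f = Abs_fps (\<lambda>n. if n = 0 then 0 else of_nat (f n))"

text \<open>
  \<^term>\<open>one_minus_X_pow n a\<close> is the binomial series $(1 - q^n)^a$, obtained by substituting
  $-q^n$ (for $n \ge 1$) into $(1 + q)^a = \sum_k {a \choose k} q^k$.
\<close>

definition one_minus_X_pow :: "nat \<Rightarrow> rat \<Rightarrow> rat fps"
  where "one_minus_X_pow n a = fps_binomial a oo (- (fps_X ^ n))"

text \<open>
  The infinite product is the limit of the partial products in the $q$-adic topology on formal
  power series. \<^const>\<open>prodinf\<close> indexes from 0, hence the \<^const>\<open>Suc\<close>.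
\<close>

definition Psi :: "(nat \<Rightarrow> nat) \<Rightarrow> rat fps"
  where "Psi f = (\<Prod>n. one_minus_X_pow (Suc n) (of_nat (f (Suc n)) / of_nat (Suc n)))"

lemma one_minus_X_pow_nth:
  assumes "k < n"
  shows "one_minus_X_pow n a $ k = (if k = 0 then 1 else 0)"
proof -
  have zero: "(- (fps_X ^ n :: rat fps)) ^ i $ k = 0" if "i > 0" for i
  proof -
    have "(- (fps_X ^ n :: rat fps)) ^ i = (if even i then fps_X ^ (n * i) else - (fps_X ^ (n * i)))"
      by (simp add: power_minus_even power_minus_odd power_mult)
    moreover from assms that have "k < n * i"
      by (cases i) auto
    ultimately show ?thesis
      by (simp add: fps_X_power_nth)
  qed
  have "one_minus_X_pow n a $ k = (\<Sum>i=0..k. (a gchoose i) * ((- (fps_X ^ n)) ^ i $ k))"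
    by (simp add: one_minus_X_pow_def fps_compose_nth)
  also have "\<dots> = (\<Sum>i\<in>{0}. (a gchoose i) * ((- (fps_X ^ n)) ^ i $ k))"
    by (rule sum.mono_neutral_right) (auto simp: zero)
  finally show ?thesis
    by simp
qed

text \<open>The product always converges, so the underlying definite description denotes.\<close>

lemma Psi_has_prod:
  "(\<lambda>n. one_minus_X_pow (Suc n) (of_nat (f (Suc n)) / of_nat (Suc n))) has_prod Psi f"
proof -
  define g where "g = (\<lambda>n. one_minus_X_pow (Suc n) (of_nat (f (Suc n)) / of_nat (Suc n)))"
  define p where "p = Abs_fps (\<lambda>k. (\<Prod>i\<le>k. g i) $ k)"
  have stable: "(\<Prod>i\<le>m + k. g i) $ k = (\<Prod>i\<le>k. g i) $ k" for m k
  proof (induction m)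
    case (Suc m)
    have "(\<Prod>i\<le>Suc m + k. g i) $ k
        = (\<Sum>j=0..k. (\<Prod>i\<le>m + k. g i) $ j * g (Suc (m + k)) $ (k - j))"
      by (simp add: fps_mult_nth)
    also have "\<dots> = (\<Sum>j\<in>{k}. (\<Prod>i\<le>m + k. g i) $ j * g (Suc (m + k)) $ (k - j))"
      by (rule sum.mono_neutral_right) (auto simp: g_def one_minus_X_pow_nth)
    also have "\<dots> = (\<Prod>i\<le>m + k. g i) $ k"
      by (simp add: g_def one_minus_X_pow_nth)
    finally show ?case
      using Suc by simp
  qed simp
  have "(\<lambda>n. \<Prod>i\<le>n. g i) \<longlonglongrightarrow> p"
  proof (rule tendsto_fpsI)
    fix k
    have "(\<Prod>i\<le>n. g i) $ k = p $ k" if "n \<ge> k" for n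
      using stable[of "n - k" k] that by (simp add: p_def)
    then show "eventually (\<lambda>n. (\<Prod>i\<le>n. g i) $ k = p $ k) sequentially"
      by (auto simp: eventually_sequentially)
  qed
  moreover have "p $ 0 = 1"
    by (simp add: p_def g_def one_minus_X_pow_nth)
  then have "p \<noteq> 0"
    by auto
  ultimately have "g has_prod p"
    by (simp add: has_prod_def raw_has_prod_def)
  then have "g has_prod prodinf g"
    using has_prod_unique by blast
  then show ?thesis
    by (simp add: Psi_def g_def)
qed

end

theory Submission
  imports Defs
begin

text \<open>
  A partition of \<open>n\<close> all of whose parts have multiplicity \<open>m\<close> is \<open>m\<close> copies of a partition of
  \<open>n/m\<close> into distinct parts, so \<open>Qhat n\<close> is the sum of \<open>Q d\<close> over the divisors \<open>d\<close> of \<open>n\<close>. On the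
  other hand, the factor $(1 - q^n)^{f(n)/n}$ has logarithmic derivative (with respect to
  $q\,d/dq$) $-f(n) q^n / (1 - q^n) = -f(n) \sum_{n \mid k,\, k > 0} q^k$, and summing over \<open>n\<close> gives
  the same divisor sums with \<open>f = Q\<close>.
\<close>

section \<open>Logarithmic derivative of a single factor\<close>

text \<open>With \<open>b\<close> standing for $-q^n$, the chain rule turns the binomial equation
  $(1+q) y' = a y$ into one for the composed series; $q b' = n b$ supplies the factor
  \<open>n\<close>. Everything is multiplied by \<open>1 + b\<close>, which is cancelled at the end,
  so no quotient of series appears.\<close>

lemma fps_X_deriv_one_minus_X_pow:
  assumes "n > 0"
  shows "fps_X * fps_deriv (one_minus_X_pow n a) =
    - fps_const (of_nat n * a) * Abs_fps (\<lambda>k. if k > 0 \<and> n dvd k then 1 else 0) * one_minus_X_pow n a"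
proof -
  define L :: "rat fps" where "L = Abs_fps (\<lambda>k. if k > 0 \<and> n dvd k then 1 else 0)"
  define b :: "rat fps" where "b = - (fps_X ^ n)"
  have b0: "b $ 0 = 0"
    using assms by (simp add: b_def)
  \<comment> \<open>\<open>L\<close> is $q^n / (1 - q^n)$ with its denominator cleared. Coefficients
    \<open>k\<close> and \<open>k - n\<close> of \<open>L\<close> agree except at
    \<open>k = n\<close>, because \<open>L\<close> has no constant term.\<close>
  have geometric: "L * (1 + b) = - b"
  proof (rule fps_ext)
    fix k
    have "(L * (1 + b)) $ k = L $ k - (if k < n then 0 else L $ (k - n))"
      by (simp add: b_def algebra_simps fps_X_power_mult_right_nth)
    also have "\<dots> = (- b) $ k"
      using assms by (auto simp: L_def b_def fps_X_power_nth dvd_minus_self dest: dvd_imp_le)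
    finally show "(L * (1 + b)) $ k = (- b) $ k" .
  qed
  have unit: "(1 + fps_X) * (h / (1 + fps_X)) = (h :: rat fps)" for h
    by (simp add: fps_divide_unit mult.left_commute inverse_mult_eq_1')
  have "(1 + fps_X) * fps_deriv (fps_binomial a) = fps_const a * fps_binomial a"
    unfolding fps_binomial_deriv by (rule unit)
  then have "((1 + fps_X) * fps_deriv (fps_binomial a)) oo b = (fps_const a * fps_binomial a) oo b"
    by simp
  then have ode: "(1 + b) * (fps_deriv (fps_binomial a) oo b) = fps_const a * one_minus_X_pow n a"
    by (simp add: fps_compose_mult_distrib[OF b0] fps_compose_add_distrib one_minus_X_pow_def
        fps_X_fps_compose_startby0[OF b0] flip: b_def)
  have deriv_b: "fps_X * fps_deriv b = fps_const (of_nat n) * b"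
    by (rule fps_ext) (auto simp: b_def fps_X_power_nth)
  have "(1 + b) * (fps_X * fps_deriv (one_minus_X_pow n a)) =
      ((1 + b) * (fps_deriv (fps_binomial a) oo b)) * (fps_X * fps_deriv b)"
    by (simp add: one_minus_X_pow_def fps_compose_deriv[OF b0] algebra_simps flip: b_def)
  also have "\<dots> = fps_const (of_nat n * a) * b * one_minus_X_pow n a"
    unfolding ode deriv_b by (simp add: algebra_simps flip: fps_const_mult)
  also have "\<dots> = - fps_const (of_nat n * a) * (L * (1 + b)) * one_minus_X_pow n a"
    unfolding geometric by (simp flip: fps_const_neg)
  also have "\<dots> = (1 + b) * (- fps_const (of_nat n * a) * L * one_minus_X_pow n a)"
    by (simp only: mult_ac)
  finally have "(1 + b) * (fps_X * fps_deriv (one_minus_X_pow n a)) =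
      (1 + b) * (- fps_const (of_nat n * a) * L * one_minus_X_pow n a)" .
  moreover have "(1 + b) $ 0 \<noteq> 0"
    using b0 by simp
  then have "1 + b \<noteq> 0"
    by (metis fps_zero_nth)
  ultimately show ?thesis
    by (simp add: L_def)
qed

section \<open>From finite products to the infinite product\<close>

text \<open>Convergence makes each coefficient of the partial products eventually equal to that of
  the limit. This later justifies dividing by \<open>Psi Q\<close>.\<close>

lemma Psi_nth_0: "Psi f $ 0 = 1"
proof -
  have "eventually (\<lambda>N. (\<Prod>i\<le>N. one_minus_X_pow (Suc i) (of_nat (f (Suc i)) / of_nat (Suc i))) $ 0
      = Psi f $ 0) sequentially"
    using has_prod_imp_tendsto[OF Psi_has_prod[of f]] by (simp add: tendsto_fps_iff)
  moreover have "(\<Prod>i\<le>N. one_minus_X_pow (Suc i) (of_nat (f (Suc i)) / of_nat (Suc i))) $ 0 = 1" for N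
    by (induction N) (simp_all add: one_minus_X_pow_nth)
  ultimately show ?thesis
    by (simp del: of_nat_Suc)
qed

text \<open>All divisors of a positive \<open>k\<close> lie between 1 and \<open>k\<close>, so the
  cutoff \<open>N\<close> loses none. Hence coefficient \<open>k\<close> of the summed logarithmic
  derivatives is constant from \<open>N = k\<close> on.\<close>

lemma sum_divisors_atMost:
  fixes f :: "nat \<Rightarrow> 'a::comm_semiring_1"
  assumes "0 < k" "k \<le> N"
  shows "(\<Sum>i\<le>N. if Suc i dvd k then f (Suc i) else 0) = (\<Sum>d | d dvd k. f d)"
proof -
  have "(\<Sum>i\<le>N. if Suc i dvd k then f (Suc i) else 0) = (\<Sum>i | i \<le> N \<and> Suc i dvd k. f (Suc i))"
    by (simp add: sum.If_cases Int_def)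
  also have "\<dots> = (\<Sum>d | d dvd k. f d)"
    using assms
    by (intro sum.reindex_bij_witness[of _ "\<lambda>d. d - 1" Suc]) (auto dest: dvd_imp_le dvd_pos_nat)
  finally show ?thesis .
qed

text \<open>A coefficient of a product involves only finitely many coefficients of the factors, each
  eventually constant.\<close>

lemma tendsto_mult_fps:
  fixes f g :: "'a \<Rightarrow> 'b::ring fps"
  assumes "(f \<longlongrightarrow> a) M" "(g \<longlongrightarrow> b) M"
  shows "((\<lambda>x. f x * g x) \<longlongrightarrow> a * b) M"
proof (rule tendsto_fpsI)
  fix n
  have "eventually (\<lambda>x. \<forall>i\<in>{0..n}. f x $ i = a $ i \<and> g x $ (n - i) = b $ (n - i)) M"
    using assms by (intro eventually_ball_finite) (auto simp: tendsto_fps_iff eventually_conj)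
  then show "eventually (\<lambda>x. (f x * g x) $ n = (a * b) $ n) M"
    by eventually_elim (simp add: fps_mult_nth)
qed

text \<open>The Leibniz rule gives the identity for every partial product; both sides converge, and
  limits are unique.\<close>

lemma fps_X_deriv_Psi:
  "fps_X * fps_deriv (Psi f) = - F (\<lambda>n. \<Sum>d | d dvd n. f d) * Psi f"
proof -
  define g where "g = (\<lambda>n. one_minus_X_pow (Suc n) (of_nat (f (Suc n)) / of_nat (Suc n)))"
  define l :: "nat \<Rightarrow> rat fps" where
    "l = (\<lambda>n. - fps_const (of_nat (f (Suc n))) * Abs_fps (\<lambda>k. if k > 0 \<and> Suc n dvd k then 1 else 0))"
  have g: "fps_X * fps_deriv (g n) = l n * g n" for n
    unfolding g_def l_def by (subst fps_X_deriv_one_minus_X_pow) (simp_all del: of_nat_Suc)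
  have partial: "fps_X * fps_deriv (\<Prod>i\<le>N. g i) = (\<Sum>i\<le>N. l i) * (\<Prod>i\<le>N. g i)" for N
  proof (induction N)
    case (Suc N)
    have "fps_X * fps_deriv (\<Prod>i\<le>Suc N. g i) =
        (fps_X * fps_deriv (\<Prod>i\<le>N. g i)) * g (Suc N) + (\<Prod>i\<le>N. g i) * (fps_X * fps_deriv (g (Suc N)))"
      by (simp add: algebra_simps)
    also have "\<dots> = (\<Sum>i\<le>Suc N. l i) * (\<Prod>i\<le>Suc N. g i)"
      by (simp add: Suc g algebra_simps)
    finally show ?case .
  qed (simp add: g)
  have g_lim: "(\<lambda>N. \<Prod>i\<le>N. g i) \<longlonglongrightarrow> Psi f"
    unfolding g_def by (rule has_prod_imp_tendsto[OF Psi_has_prod])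
  have l_lim: "(\<lambda>N. \<Sum>i\<le>N. l i) \<longlonglongrightarrow> - F (\<lambda>n. \<Sum>d | d dvd n. f d)"
  proof (rule tendsto_fpsI)
    fix k
    have "(\<Sum>i\<le>N. l i) $ k = (- F (\<lambda>n. \<Sum>d | d dvd n. f d)) $ k" if "N \<ge> k" for N
    proof (cases "k = 0")
      case False
      have "(\<Sum>i\<le>N. l i) $ k = - (\<Sum>i\<le>N. if Suc i dvd k then of_nat (f (Suc i)) else 0)"
        unfolding sum_negf[symmetric] fps_sum_nth
        using False by (intro sum.cong) (auto simp: l_def simp flip: fps_const_neg)
      with False that show ?thesis
        by (simp add: sum_divisors_atMost[of k N "\<lambda>d. of_nat (f d)"] F_def)
    qed (simp add: fps_sum_nth l_def F_def flip: fps_const_neg)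
    then show "eventually (\<lambda>N. (\<Sum>i\<le>N. l i) $ k = (- F (\<lambda>n. \<Sum>d | d dvd n. f d)) $ k) sequentially"
      by (auto simp: eventually_sequentially)
  qed
  \<comment> \<open>Differentiation is continuous: coefficient \<open>k\<close> of the derivative
    depends only on coefficient \<open>k + 1\<close>.\<close>
  have "(\<lambda>N. fps_deriv (\<Prod>i\<le>N. g i)) \<longlonglongrightarrow> fps_deriv (Psi f)"
    using g_lim by (auto simp: tendsto_fps_iff elim: eventually_mono)
  then have "(\<lambda>N. fps_X * fps_deriv (\<Prod>i\<le>N. g i)) \<longlonglongrightarrow> fps_X * fps_deriv (Psi f)"
    by (intro tendsto_mult_fps tendsto_const)
  moreover have "(\<lambda>N. fps_X * fps_deriv (\<Prod>i\<le>N. g i)) \<longlonglongrightarrow> - F (\<lambda>n. \<Sum>d | d dvd n. f d) * Psi f"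
    unfolding partial by (intro tendsto_mult_fps l_lim g_lim)
  ultimately show ?thesis
    by (rule LIMSEQ_unique)
qed

section \<open>Partitions with equal multiplicities\<close>

lemma sum_mset_repeat_mset: "sum_mset (repeat_mset n M) = n * sum_mset M" for M :: "nat multiset"
  by (induction n) simp_all

text \<open>Pairs are indexed by the sum \<open>d\<close> of the distinct partition, so the
  multiplicity is \<open>n div d\<close>. The inverse \<open>?g\<close> keeps one copy of each part
  and records the sum.\<close>

lemma Qhat_eq_sum_Q:
  assumes "n > 0"
  shows "Qhat n = (\<Sum>d | d dvd n. Q d)"
proof -
  let ?D = "\<lambda>d. {P \<in> partitions d. \<forall>x\<in>#P. count P x = 1}"
  let ?E = "{P \<in> partitions n. \<forall>x\<in>#P. \<forall>y\<in>#P. count P x = count P y}"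
  let ?f = "\<lambda>(d, R :: nat multiset). repeat_mset (n div d) R"
  let ?g = "\<lambda>P :: nat multiset. (sum_mset (mset_set (set_mset P)), mset_set (set_mset P))"
  have "bij_betw ?f (SIGMA d:{d. d dvd n}. ?D d) ?E"
  proof (rule bij_betw_byWitness[where f' = ?g])
    have support: "set_mset (repeat_mset (n div d) R) = set_mset R" if "d dvd n" for d and R :: "nat multiset"
      using assms that by (auto simp flip: count_greater_zero_iff simp: dvd_div_eq_0_iff)
    have distinct: "mset_set (set_mset R) = R" if "R \<in> ?D d" for R d
      using that by (intro multiset_eqI) (auto simp: count_mset_set' not_in_iff)
    show "\<forall>x \<in> (SIGMA d:{d. d dvd n}. ?D d). ?g (?f x) = x"
      using support distinct by (auto simp: partitions_def)
    show "?f ` (SIGMA d:{d. d dvd n}. ?D d) \<subseteq> ?E"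
      using support by (auto simp: partitions_def sum_mset_repeat_mset)
    have equal: "?f (?g P) = P \<and> fst (?g P) dvd n" if "P \<in> ?E" for P
    proof -
      \<comment> \<open>A part exists since \<open>n > 0\<close>; the common multiplicity
        \<open>m\<close> is read off from it.\<close>
      from that assms have "P \<noteq> {#}"
        by (auto simp: partitions_def)
      then obtain x where x: "x \<in># P"
        by auto
      define R m where "R = mset_set (set_mset P)" and "m = count P x"
      have P: "repeat_mset m R = P"
      proof (rule multiset_eqI)
        fix y
        show "count (repeat_mset m R) y = count P y"
        proof (cases "y \<in># P")
          case True
          then have "count P y = m"
            using \<open>P \<in> ?E\<close> x unfolding m_def by blast
          with True show ?thesis
            by (simp add: R_def count_mset_set')
        next
          case False
          then show ?thesis
            by (simp add: R_def count_mset_set' count_eq_zero_iff)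
        qed
      qed
      have "n = sum_mset P"
        using that by (simp add: partitions_def)
      then have n: "n = m * sum_mset R"
        by (simp add: sum_mset_repeat_mset flip: P)
      with assms have "n div sum_mset R = m" "sum_mset R dvd n"
        by auto
      with P show ?thesis
        by (simp flip: R_def)
    qed
    then show "\<forall>P \<in> ?E. ?f (?g P) = P"
      by blast
    show "?g ` ?E \<subseteq> (SIGMA d:{d. d dvd n}. ?D d)"
      using equal by (auto simp: partitions_def count_mset_set')
  qed
  then have "card (SIGMA d:{d. d dvd n}. ?D d) = card ?E"
    by (rule bij_betw_same_card)
  moreover have "finite {d. d dvd n}" "\<And>d. finite (?D d)"
    using assms finite_partitions by auto
  ultimately show ?thesis
    by (simp add: Q_def Qhat_def)
qed

section \<open>Moebius inversion\<close>

lemma prime_factors_prod_primes: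
  fixes S :: "nat set"
  assumes "finite S" "\<And>p. p \<in> S \<Longrightarrow> prime p"
  shows "prime_factors (\<Prod>S) = S"
  using assms by (subst prime_factors_prod) (auto simp: prime_prime_factors dest: not_prime_0[THEN notE])

lemma squarefree_prod_primes:
  fixes S :: "nat set"
  assumes "\<And>p. p \<in> S \<Longrightarrow> prime p"
  shows "squarefree (\<Prod>S)"
  using assms by (intro squarefree_prod_coprime) (auto intro: primes_coprime squarefree_prime)

lemma squarefree_eq_prod_prime_factors:
  fixes n :: nat
  assumes "squarefree n"
  shows "\<Prod>(prime_factors n) = n"
proof -
  have n: "n \<noteq> 0"
    using assms by (metis not_squarefree_0)
  have "(\<Prod>p\<in>prime_factors n. p ^ multiplicity p n) = \<Prod>(prime_factors n)"
    using assms n by (intro prod.cong) (auto simp: squarefree_factorial_semiring')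
  with n show ?thesis
    by (simp add: prod_prime_factors)
qed

text \<open>Only squarefree divisors contribute, and they correspond to the sets of prime factors of
  \<open>n\<close>. The alternating sum over these sets expands a product of factors
  \<open>-1 + 1\<close>, which is 0 unless it is empty, that is, \<open>n = 1\<close>.\<close>

lemma sum_moebius_mu:
  assumes "n > 0"
  shows "(\<Sum>d | d dvd n. moebius_mu d) = (if n = 1 then 1 else 0)"
proof -
  have "(\<Sum>d | d dvd n. moebius_mu d) = (\<Sum>d | d dvd n \<and> squarefree d. (-1) ^ card (prime_factors d))"
    using assms by (intro sum.mono_neutral_cong_right) (auto simp: moebius_mu_def)
  also have "\<dots> = (\<Sum>S \<in> Pow (prime_factors n). (-1) ^ card S)"
  proof (rule sum.reindex_bij_witness[of _ Prod prime_factors])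
    fix S assume S: "S \<in> Pow (prime_factors n)"
    then have fin: "finite S" and prime: "\<And>p. p \<in> S \<Longrightarrow> prime p"
      by (auto intro: finite_subset)
    show "prime_factors (\<Prod>S) = S"
      using fin prime by (rule prime_factors_prod_primes)
    have "\<Prod>S dvd \<Prod>(prime_factors n)"
      using S by (intro prod_dvd_prod_subset) auto
    also have "\<dots> dvd (\<Prod>p\<in>prime_factors n. p ^ multiplicity p n)"
      by (intro prod_dvd_prod) (auto intro!: dvd_power simp: prime_factors_multiplicity)
    also have "\<dots> = n"
      using assms by (simp add: prod_prime_factors)
    finally show "\<Prod>S \<in> {d. d dvd n \<and> squarefree d}"
      using prime by (simp add: squarefree_prod_primes)
  qed (use assms in \<open>auto simp: squarefree_eq_prod_prime_factors dest: dvd_prime_factors[THEN subsetD, rotated -1]\<close>)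
  also have "\<dots> = (\<Prod>p\<in>prime_factors n. -1 + 1)"
    by (subst prod_add) simp_all
  also have "\<dots> = (if n = 1 then 1 else 0)"
    using assms by (auto simp: power_0_left prime_factorization_empty_iff)
  finally show ?thesis .
qed

text \<open>After inserting the divisor sums and exchanging summations, \<open>f e\<close> is
  weighted by the sum of \<open>moebius_mu\<close> over the divisors of \<open>n div e\<close>,
  which vanishes unless \<open>e = n\<close>.\<close>

lemma moebius_inversion:
  fixes f g :: "nat \<Rightarrow> int"
  assumes g: "\<And>m. m > 0 \<Longrightarrow> g m = (\<Sum>d | d dvd m. f d)" and n: "n > 0"
  shows "f n = (\<Sum>d | d dvd n. moebius_mu d * g (n div d))"
proof -
  have "(\<Sum>d | d dvd n. moebius_mu d * g (n div d))
      = (\<Sum>d | d dvd n. \<Sum>e | e dvd n div d. moebius_mu d * f e)"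
    using n by (intro sum.cong) (auto simp: g sum_distrib_left dvd_div_eq_0_iff)
  also have "\<dots> = (\<Sum>e | e dvd n. \<Sum>d | d dvd n div e. moebius_mu d * f e)"
  proof -
    \<comment> \<open>The condition \<open>d * e dvd n\<close> is symmetric, so the same fact serves
      before and after the exchange.\<close>
    have divisors: "{e. e dvd n div d} = {e \<in> {e. e dvd n}. d * e dvd n}" if "d dvd n" for d
      using that n by (auto simp: dvd_div_iff_mult mult.commute intro: dvd_mult_right)
    have "(\<Sum>d | d dvd n. \<Sum>e | e dvd n div d. moebius_mu d * f e)
        = (\<Sum>d | d dvd n. \<Sum>e | e \<in> {e. e dvd n} \<and> d * e dvd n. moebius_mu d * f e)"
      by (intro sum.cong refl divisors) simp
    also have "\<dots> = (\<Sum>e | e dvd n. \<Sum>d | d \<in> {d. d dvd n} \<and> d * e dvd n. moebius_mu d * f e)"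
      using n by (intro sum.swap_restrict) auto
    also have "\<dots> = (\<Sum>e | e dvd n. \<Sum>d | d dvd n div e. moebius_mu d * f e)"
      by (intro sum.cong refl) (simp_all add: divisors mult.commute)
    finally show ?thesis .
  qed
  also have "\<dots> = (\<Sum>e | e dvd n. if e = n then f n else 0)"
  proof (intro sum.cong refl)
    fix e assume "e \<in> {e. e dvd n}"
    then have e: "e dvd n" "n div e > 0" "n div e = 1 \<longleftrightarrow> e = n"
      using n by (auto simp: dvd_div_eq_0_iff)
    show "(\<Sum>d | d dvd n div e. moebius_mu d * f e) = (if e = n then f n else 0)"
      using e n by (simp add: sum_moebius_mu flip: sum_distrib_right)
  qed
  also have "\<dots> = f n"
    using n by simp
  finally show ?thesis ..
qed

theorem theorem2p1:
  shows "fps_X * fps_deriv (Psi Q) / Psi Q = - F Qhat \<and>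
    (\<forall>n\<ge>1. int (Q n) = (\<Sum>d | d dvd n. moebius_mu d * int (Qhat (n div d))))"
proof
  \<comment> \<open>\<open>F\<close> sets the constant term to 0, so only positive indices are
    compared.\<close>
  have "F (\<lambda>n. \<Sum>d | d dvd n. Q d) = F Qhat"
    by (rule fps_ext) (simp add: F_def Qhat_eq_sum_Q)
  moreover have "Psi Q \<noteq> 0"
    using Psi_nth_0[of Q] by auto
  ultimately show "fps_X * fps_deriv (Psi Q) / Psi Q = - F Qhat"
    by (simp add: fps_X_deriv_Psi del: mult_minus_left)
  show "\<forall>n\<ge>1. int (Q n) = (\<Sum>d | d dvd n. moebius_mu d * int (Qhat (n div d)))"
    by (auto intro!: moebius_inversion simp: Qhat_eq_sum_Q)
qed

end
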